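(* Let $U$ be an open domain in a complex Banach space $X$. A function $f\in C^2(U;\mathbb{R})$ is strictly plurisubharmonic continuously if and only if it is strictly plurisubharmonic on average continuously.
   Context: Let $\|\cdot\|$ be the norm of $X$ and $C(U)$ the real-valued continuous functions on $U$. For a (real-)differentiable $f$ with Fréchet derivative $Df(a)$, let $D'f(a)(b)=\frac12[Df(a)(b)-iDf(a)(ib)]$ and $D''f(a)(b)=\frac12[Df(a)(b)+iDf(a)(ib)]$ be its complex-linear and complex-antilinear parts. For $f\in C^2(U;\mathbb{R})$ the complex Hessian is $D'D''f(a)(b,b)$, i.e. $D'(D''f)(a)(b)(b)=\frac{\partial^2}{\partial z\,\partial\bar z}f(a+zb)\big|_{z=0}$ (with $z\in\mathbb{C}$). $f\in C^2(U;\mathbb{R})$ is strictly plurisubharmonic continuously if there exists a positive $\psi\in C(U)$ such that $D'D''f(a)(b,b)\ge\psi(a)\|b\|^2$ for all $a\in U$, $b\in X$. An upper semicontinuous $g:U\to[-\infty,\infty)$ is strictly plurisubharmonic on average continuously if there exist a positive $\varphi\in C(U)$ and a lower semicontinuous $\delta:U\to(0,\infty)$ such that for all $a\in U$ and all $b\in X$ with $\|b\|<\delta(a)$ (where $\delta(a)$ is small enough that $a+\overline{\mathbb{D}}b\subset U$ for such $b$, $\overline{\mathbb D}$ being the closed unit disk of $\mathbb{C}$), $$\varphi(a)\|b\|^2+g(a)\le\frac1{2\pi}\int_0^{2\pi}g(a+e^{i\theta}b)\,d\theta.$$ *)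

theory Defs
  imports "HOL-Analysis.Analysis"
begin

section \<open>Complex normed spaces\<close>

class complex_normed_vector = real_normed_vector +
  fixes scaleC :: "complex \<Rightarrow> 'a \<Rightarrow> 'a" (infixr \<open>*\<^sub>C\<close> 75)
  assumes scaleC_add_right: "c *\<^sub>C (x + y) = c *\<^sub>C x + c *\<^sub>C y"
    and scaleC_add_left: "(c + d) *\<^sub>C x = c *\<^sub>C x + d *\<^sub>C x"
    and scaleC_scaleC: "c *\<^sub>C (d *\<^sub>C x) = (c * d) *\<^sub>C x"
    and scaleC_of_real: "complex_of_real r *\<^sub>C x = r *\<^sub>R x"
    and norm_scaleC: "norm (c *\<^sub>C x) = cmod c * norm x"

class complex_banach = complex_normed_vector + banach

lemma bounded_linear_scaleC_right: "bounded_linear (\<lambda>x :: 'a::complex_normed_vector. c *\<^sub>C x)"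
proof (rule bounded_linear_intro[where K = "cmod c"])
  fix x y :: 'a and r :: real
  show "c *\<^sub>C (x + y) = c *\<^sub>C x + c *\<^sub>C y"
    by (rule scaleC_add_right)
  show "c *\<^sub>C (r *\<^sub>R x) = r *\<^sub>R (c *\<^sub>C x)"
    by (simp only: scaleC_of_real[symmetric] scaleC_scaleC mult.commute)
  show "norm (c *\<^sub>C x) \<le> norm x * cmod c"
    by (simp add: norm_scaleC mult.commute)
qed

instantiation complex :: complex_banach
begin

definition scaleC_complex :: "complex \<Rightarrow> complex \<Rightarrow> complex"
  where "scaleC_complex c x = c * x"

instance
  by standard (simp_all add: scaleC_complex_def algebra_simps norm_mult scaleR_conv_of_real)

end

text \<open>Real-linear bounded maps into a complex space form a complex space; this is what lets the
  operators $D'$ (\<open>D_lin\<close>) and $D''$ (\<open>D_antilin\<close>) below be iterated.\<close>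

instantiation blinfun :: (real_normed_vector, complex_normed_vector) complex_normed_vector
begin

lift_definition scaleC_blinfun :: "complex \<Rightarrow> 'a \<Rightarrow>\<^sub>L 'b \<Rightarrow> 'a \<Rightarrow>\<^sub>L 'b" is "\<lambda>c F x. c *\<^sub>C F x"
  by (rule bounded_linear_compose[OF bounded_linear_scaleC_right])

instance
proof
  fix c d :: complex and F G :: "'a \<Rightarrow>\<^sub>L 'b" and r :: real
  show "c *\<^sub>C (F + G) = c *\<^sub>C F + c *\<^sub>C G"
    by transfer (simp add: scaleC_add_right)
  show "(c + d) *\<^sub>C F = c *\<^sub>C F + d *\<^sub>C F"
    by transfer (simp add: scaleC_add_left)
  show "c *\<^sub>C (d *\<^sub>C F) = (c * d) *\<^sub>C F"
    by transfer (simp add: scaleC_scaleC)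
  show "complex_of_real r *\<^sub>C F = r *\<^sub>R F"
    by transfer (simp add: scaleC_of_real)
  show "norm (c *\<^sub>C F) = cmod c * norm F"
  proof (rule antisym)
    have le: "norm (e *\<^sub>C H) \<le> cmod e * norm H" for e and H :: "'a \<Rightarrow>\<^sub>L 'b"
    proof (rule norm_blinfun_bound)
      fix x
      have "norm (blinfun_apply (e *\<^sub>C H) x) = cmod e * norm (blinfun_apply H x)"
        by transfer (simp add: norm_scaleC)
      also have "\<dots> \<le> cmod e * (norm H * norm x)"
        by (intro mult_left_mono norm_blinfun) simp
      finally show "norm (blinfun_apply (e *\<^sub>C H) x) \<le> cmod e * norm H * norm x"
        by (simp add: mult.assoc)
    qed simp
    show "norm (c *\<^sub>C F) \<le> cmod c * norm F"
      by (rule le)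
    show "cmod c * norm F \<le> norm (c *\<^sub>C F)"
    proof (cases "c = 0")
      case False
      have "inverse c *\<^sub>C c *\<^sub>C F = F"
        using False by transfer (simp add: scaleC_scaleC scaleC_of_real[of 1, simplified])
      then have "norm F \<le> inverse (cmod c) * norm (c *\<^sub>C F)"
        by (metis le norm_inverse)
      then have "cmod c * norm F \<le> cmod c * (inverse (cmod c) * norm (c *\<^sub>C F))"
        by (intro mult_left_mono) simp_all
      then show ?thesis
        using False by (simp add: mult.assoc[symmetric])
    qed simp
  qed
qed

end

section \<open>Complex derivatives and the complex Hessian\<close>

definition fderiv :: "('a::real_normed_vector \<Rightarrow> 'b::real_normed_vector) \<Rightarrow> 'a \<Rightarrow> 'a \<Rightarrow>\<^sub>L 'b"
  where "fderiv f a = Blinfun (frechet_derivative f (at a))"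

definition mult_i :: "'a::complex_normed_vector \<Rightarrow>\<^sub>L 'a"
  where "mult_i = Blinfun (\<lambda>x. \<i> *\<^sub>C x)"

definition D_lin ::
    "('a::complex_normed_vector \<Rightarrow> 'b::complex_normed_vector) \<Rightarrow> 'a \<Rightarrow> 'a \<Rightarrow>\<^sub>L 'b"
  where "D_lin f a = (1/2) *\<^sub>R (fderiv f a - \<i> *\<^sub>C (fderiv f a o\<^sub>L mult_i))"

definition D_antilin ::
    "('a::complex_normed_vector \<Rightarrow> 'b::complex_normed_vector) \<Rightarrow> 'a \<Rightarrow> 'a \<Rightarrow>\<^sub>L 'b"
  where "D_antilin f a = (1/2) *\<^sub>R (fderiv f a + \<i> *\<^sub>C (fderiv f a o\<^sub>L mult_i))"

lemma blinfun_apply_scaleC: "blinfun_apply (c *\<^sub>C F) x = c *\<^sub>C blinfun_apply F x"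
  by transfer simp

lemma blinfun_apply_fderiv:
  "f differentiable (at a) \<Longrightarrow> blinfun_apply (fderiv f a) = frechet_derivative f (at a)"
  unfolding fderiv_def
  by (rule bounded_linear_Blinfun_apply)
     (meson frechet_derivative_works has_derivative_bounded_linear)

lemma fderiv_has_derivative:
  "f differentiable (at a) \<Longrightarrow> (f has_derivative blinfun_apply (fderiv f a)) (at a)"
  by (metis blinfun_apply_fderiv frechet_derivative_works)

lemma blinfun_apply_mult_i: "blinfun_apply mult_i x = \<i> *\<^sub>C x"
  unfolding mult_i_def by (simp add: bounded_linear_Blinfun_apply[OF bounded_linear_scaleC_right])

lemma D_lin_apply:
  "blinfun_apply (D_lin f a) b =
    (1/2) *\<^sub>R (blinfun_apply (fderiv f a) b - \<i> *\<^sub>C blinfun_apply (fderiv f a) (\<i> *\<^sub>C b))"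
  by (simp add: D_lin_def blinfun.bilinear_simps blinfun_apply_scaleC blinfun_apply_mult_i)

lemma D_antilin_apply:
  "blinfun_apply (D_antilin f a) b =
    (1/2) *\<^sub>R (blinfun_apply (fderiv f a) b + \<i> *\<^sub>C blinfun_apply (fderiv f a) (\<i> *\<^sub>C b))"
  by (simp add: D_antilin_def blinfun.bilinear_simps blinfun_apply_scaleC blinfun_apply_mult_i)

definition C2_on :: "'a::real_normed_vector set \<Rightarrow> ('a \<Rightarrow> real) \<Rightarrow> bool"
  where "C2_on U f \<longleftrightarrow>
    (\<forall>x\<in>U. f differentiable (at x)) \<and>
    (\<forall>x\<in>U. fderiv f differentiable (at x)) \<and>
    continuous_on U (fderiv (fderiv f))"

text \<open>\<open>complex_hessian f a b c\<close> is $D'(D''f)(a)(b)(c)$: the outer derivative acts on the map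
  \<open>D_antilin f\<close> with values in the bounded real-linear maps, and its direction is \<open>b\<close>.\<close>

definition complex_hessian :: "('a::complex_normed_vector \<Rightarrow> real) \<Rightarrow> 'a \<Rightarrow> 'a \<Rightarrow> 'a \<Rightarrow> complex"
  where "complex_hessian f a b c =
    blinfun_apply (blinfun_apply (D_lin (D_antilin (\<lambda>x. complex_of_real (f x))) a) b) c"

section \<open>Strict plurisubharmonicity\<close>

text \<open>For a \<open>C\<^sup>2\<close> function the number \<open>complex_hessian f a b b\<close> is real, by the symmetry of
  the second derivative, so that taking its real part loses nothing.\<close>

definition strictly_psh_continuously :: "'a::complex_normed_vector set \<Rightarrow> ('a \<Rightarrow> real) \<Rightarrow> bool"
  where "strictly_psh_continuously U f \<longleftrightarrow>
    C2_on U f \<and>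
    (\<exists>\<psi> :: 'a \<Rightarrow> real. continuous_on U \<psi> \<and> (\<forall>a\<in>U. 0 < \<psi> a) \<and>
      (\<forall>a\<in>U. \<forall>b. Re (complex_hessian f a b b) \<ge> \<psi> a * (norm b)\<^sup>2))"

definition upper_semicontinuous_on ::
    "'a::topological_space set \<Rightarrow> ('a \<Rightarrow> 'b::linorder_topology) \<Rightarrow> bool"
  where "upper_semicontinuous_on U g \<longleftrightarrow> (\<forall>c. openin (top_of_set U) {x\<in>U. g x < c})"

definition lower_semicontinuous_on ::
    "'a::topological_space set \<Rightarrow> ('a \<Rightarrow> 'b::linorder_topology) \<Rightarrow> bool"
  where "lower_semicontinuous_on U g \<longleftrightarrow> (\<forall>c. openin (top_of_set U) {x\<in>U. c < g x})"

text \<open>The mean of an extended real function over the circle of radius \<open>norm b\<close> about \<open>a\<close>, as the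
  integral of the positive part minus that of the negative part (\<open>e2ennreal\<close> sends negative
  numbers to 0). An upper semicontinuous function with values below \<open>\<infinity>\<close> is bounded above on the
  circle, so the first integral is finite and the difference is never of the form \<open>\<infinity> - \<infinity>\<close>.\<close>

definition circle_mean :: "('a::complex_normed_vector \<Rightarrow> ereal) \<Rightarrow> 'a \<Rightarrow> 'a \<Rightarrow> ereal"
  where "circle_mean g a b = ereal (1 / (2 * pi)) *
    (enn2ereal (\<integral>\<^sup>+\<theta>\<in>{0..2 * pi}. e2ennreal (g (a + exp (\<i> * complex_of_real \<theta>) *\<^sub>C b)) \<partial>lborel) -
     enn2ereal (\<integral>\<^sup>+\<theta>\<in>{0..2 * pi}. e2ennreal (- g (a + exp (\<i> * complex_of_real \<theta>) *\<^sub>C b)) \<partial>lborel))"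

definition strictly_psh_on_average_continuously ::
    "'a::complex_normed_vector set \<Rightarrow> ('a \<Rightarrow> ereal) \<Rightarrow> bool"
  where "strictly_psh_on_average_continuously U g \<longleftrightarrow>
    upper_semicontinuous_on U g \<and> (\<forall>x\<in>U. g x < \<infinity>) \<and>
    (\<exists>(\<phi> :: 'a \<Rightarrow> real) (\<delta> :: 'a \<Rightarrow> real).
      continuous_on U \<phi> \<and> (\<forall>a\<in>U. 0 < \<phi> a) \<and>
      lower_semicontinuous_on U \<delta> \<and> (\<forall>a\<in>U. 0 < \<delta> a) \<and>
      (\<forall>a\<in>U. \<forall>b. norm b < \<delta> a \<longrightarrow>
        (\<forall>z. cmod z \<le> 1 \<longrightarrow> a + z *\<^sub>C b \<in> U) \<and>
        ereal (\<phi> a * (norm b)\<^sup>2) + g a \<le> circle_mean g a b))"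

end

theory Submission
  imports Defs
begin

text \<open>
  Write $L_x(b)$ for the complex Hessian of $f$ at $x$ in the direction $b$, a quarter of the
  Laplacian of $z \mapsto f(x + zb)$ at $0$ (\<open>Re_complex_hessian\<close>). Everything rests on one
  comparison (\<open>circle_mean_ge_of_levi_form_ge\<close>): if $L_{a + zb}(b) \ge c$ on the closed unit disc
  of the $z$-plane, then the mean of $f$ over the circle $a + e^{i\theta} b$ is at least
  $f(a) + c$. Indeed, the function $z \mapsto f(a + zb) - c|z|^2$ is then subharmonic.

  If $L_x(b) \ge \psi(x) \|b\|^2$, the comparison needs a lower bound for $\psi$ on a whole disc
  about $a$ in terms of $a$ alone, and the radius in which it holds has to depend
  semicontinuously on $a$. Both follow at once if $\psi$ is first replaced by a smaller
  1-Lipschitz function $\mu$ that is positive exactly on $U$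
  (\<open>ex_positive_Lipschitz_minorant\<close>): within distance $\mu(a)/2$ of $a$ it stays above
  $\mu(a)/2$, so that one never leaves $U$, and $\phi = \delta = \mu/2$ has the required properties.

  Conversely, let the mean value inequality hold with $\phi$. If
  $L_a(b) < c < \phi(a) \|b\|^2$ for some $a$ and $b$, then by continuity $L_x(b) < c$ near $a$, and
  the comparison for $-f$ on a disc of small radius $t$ bounds the mean over the circle
  $a + t e^{i\theta} b$ by $f(a) + t^2 c$, which contradicts the assumed lower bound
  $f(a) + t^2 \phi(a) \|b\|^2$. Hence $\psi = \phi$ works.
\<close>

section \<open>Scalar multiplication and the Levi form\<close>

lemma bounded_bilinear_scaleC:
  "bounded_bilinear (\<lambda>(c::complex) (x::'a::complex_normed_vector). c *\<^sub>C x)"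
proof (rule bounded_bilinear.intro)
  show "\<exists>K. \<forall>(c::complex) (x::'a). norm (c *\<^sub>C x) \<le> norm c * norm x * K"
    by (intro exI[of _ 1]) (simp add: norm_scaleC)
  fix a :: complex and r :: real and b :: 'a
  show "(r *\<^sub>R a) *\<^sub>C b = r *\<^sub>R (a *\<^sub>C b)"
    by (metis scaleC_of_real scaleC_scaleC scaleR_conv_of_real)
  show "a *\<^sub>C (r *\<^sub>R b) = r *\<^sub>R (a *\<^sub>C b)"
    by (metis scaleC_of_real scaleC_scaleC mult.commute)
qed (simp_all add: scaleC_add_left scaleC_add_right)

lemma scaleC_minus_one: "(-1) *\<^sub>C x = - (x::'a::complex_normed_vector)"
  using scaleC_of_real[of "-1" x] by simp

lemma scaleC_i_i: "\<i> *\<^sub>C \<i> *\<^sub>C x = - (x::'a::complex_normed_vector)"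
  by (simp add: scaleC_scaleC scaleC_minus_one)

lemma scaleR_scaleC: "r *\<^sub>R (c *\<^sub>C x) = (of_real r * c) *\<^sub>C (x::'a::complex_normed_vector)"
  by (simp add: scaleC_scaleC flip: scaleC_of_real)

lemma scaleC_Re_Im: "z *\<^sub>C x = Re z *\<^sub>R x + Im z *\<^sub>R (\<i> *\<^sub>C (x::'a::complex_normed_vector))"
proof -
  have "z *\<^sub>C x = (of_real (Re z) + of_real (Im z) * \<i>) *\<^sub>C x"
    using complex_eq[of z] by (simp only: mult.commute)
  then show ?thesis
    by (simp only: scaleC_add_left scaleC_of_real scaleR_scaleC)
qed

text \<open>If $H$ is the second derivative of $u$ at $a$, this is a quarter of the Laplacian of $z \mapsto u(a + zb)$
  at $0$.\<close>

definition levi_form :: "('a::complex_normed_vector \<Rightarrow>\<^sub>L 'a \<Rightarrow>\<^sub>L real) \<Rightarrow> 'a \<Rightarrow> real"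
  where "levi_form H b =
    (blinfun_apply (blinfun_apply H b) b
      + blinfun_apply (blinfun_apply H (\<i> *\<^sub>C b)) (\<i> *\<^sub>C b)) / 4"

text \<open>With $z = x + iy$, the mixed terms $H(b, ib)$ and $H(ib, b)$ appear with the factor $xy$ in
  $H(zb, zb)$ and with $-xy$ in $H(izb, izb)$, so they cancel.\<close>

lemma levi_form_scaleC: "levi_form H (z *\<^sub>C b) = (cmod z)\<^sup>2 * levi_form H b"
proof -
  have i_rotate: "\<i> *\<^sub>C (Re z *\<^sub>R b + Im z *\<^sub>R (\<i> *\<^sub>C b)) = Re z *\<^sub>R (\<i> *\<^sub>C b) - Im z *\<^sub>R b"
  proof -
    have "\<i> *\<^sub>C z *\<^sub>C b = z *\<^sub>C \<i> *\<^sub>C b"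
      by (simp add: scaleC_scaleC mult.commute)
    then show ?thesis
      by (simp add: scaleC_Re_Im[of z "\<i> *\<^sub>C b"] scaleC_i_i flip: scaleC_Re_Im[of z b])
  qed
  show ?thesis
    unfolding levi_form_def cmod_power2 scaleC_Re_Im[of z b] i_rotate
    by (simp add: blinfun.bilinear_simps field_simps power2_eq_square)
qed

lemma levi_form_uminus: "levi_form (- H) b = - levi_form H b"
  by (simp add: levi_form_def blinfun.minus_left field_simps)

text \<open>On $U$ the map $D'' f$ is the image of the derivative of $f$ under the fixed bounded linear map
  $F \mapsto \frac12 (F + i F(i\,\cdot))$, so its derivative is the image of the second derivative.
  Expanding $D'D'' f(a)(b)(b)$ gives the Levi form plus $\frac{i}{4}$ times the defect
  $D^2 f(a)(b)(ib) - D^2 f(a)(ib)(b)$ of symmetry, which is purely imaginary.\<close>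

lemma Re_complex_hessian:
  fixes f :: "'a::complex_normed_vector \<Rightarrow> real"
  assumes "open U" and f: "C2_on U f" and a: "a \<in> U"
  shows "Re (complex_hessian f a b b) = levi_form (fderiv (fderiv f) a) b"
proof -
  \<comment> \<open>The inclusion of the reals into the complex numbers, as a bounded linear map.\<close>
  define T where "T = Blinfun (complex_of_real)"
  have T [simp]: "blinfun_apply T x = complex_of_real x" for x
    by (simp add: T_def bounded_linear_Blinfun_apply[OF bounded_linear_of_real])
  define \<Phi> where "\<Phi> F = (1/2) *\<^sub>R ((T o\<^sub>L F) + \<i> *\<^sub>C ((T o\<^sub>L F) o\<^sub>L mult_i))"
    for F :: "'a \<Rightarrow>\<^sub>L real"
  have \<Phi>: "bounded_linear \<Phi>"
    unfolding \<Phi>_def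
    by (intro bounded_linear_scaleR_right[THEN bounded_linear_compose] bounded_linear_add
        bounded_linear_compose[OF bounded_linear_scaleC_right]
        bounded_linear_compose[OF bounded_bilinear.bounded_linear_left[OF bounded_bilinear_blinfun_compose]]
        bounded_bilinear.bounded_linear_right[OF bounded_bilinear_blinfun_compose])
  have \<Phi>_apply: "blinfun_apply (\<Phi> F) c = (1/2) *\<^sub>R (of_real (F c) + \<i> * of_real (F (\<i> *\<^sub>C c)))"
    for F c
    by (simp add: \<Phi>_def blinfun.bilinear_simps blinfun_apply_scaleC blinfun_apply_mult_i
        scaleC_complex_def)
  have 1: "D_antilin (\<lambda>x. complex_of_real (f x)) x = \<Phi> (fderiv f x)" if "x \<in> U" for x
  proof -
    have "f differentiable (at x)"
      using f that by (simp add: C2_on_def)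
    then have "(f has_derivative blinfun_apply (fderiv f x)) (at x)"
      by (rule fderiv_has_derivative)
    then have d: "((\<lambda>x. complex_of_real (f x)) has_derivative blinfun_apply (T o\<^sub>L fderiv f x)) (at x)"
      by (auto intro!: derivative_eq_intros)
    then have "fderiv (\<lambda>x. complex_of_real (f x)) x = T o\<^sub>L fderiv f x"
      unfolding fderiv_def by (metis blinfun_apply_inverse frechet_derivative_at)
    then show ?thesis
      by (simp add: D_antilin_def \<Phi>_def)
  qed
  have "fderiv f differentiable (at a)"
    using f a by (simp add: C2_on_def)
  then have "(fderiv f has_derivative blinfun_apply (fderiv (fderiv f) a)) (at a)"
    by (rule fderiv_has_derivative)
  then have "((\<lambda>x. \<Phi> (fderiv f x)) has_derivative (\<lambda>h. \<Phi> (fderiv (fderiv f) a h))) (at a)"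
    by (rule bounded_linear.has_derivative[OF \<Phi>])
  then have d: "(D_antilin (\<lambda>x. complex_of_real (f x)) has_derivative
      (\<lambda>h. \<Phi> (fderiv (fderiv f) a h))) (at a)"
    by (rule has_derivative_transform_within_open[OF _ \<open>open U\<close> a]) (simp add: 1)
  have "blinfun_apply (fderiv (D_antilin (\<lambda>x. complex_of_real (f x))) a) h
      = \<Phi> (fderiv (fderiv f) a h)" for h
    using d by (metis blinfun_apply_fderiv differentiableI frechet_derivative_at)
  then show ?thesis
    unfolding complex_hessian_def levi_form_def
    by (simp add: D_lin_apply blinfun.bilinear_simps blinfun_apply_scaleC \<Phi>_apply
        scaleC_complex_def)
qed

section \<open>Means over circles\<close>

text \<open>A continuous function is bounded on the circle, so the integrals of its positive and negative
  parts are finite and their difference can be formed among the reals.\<close>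

lemma circle_mean_continuous:
  assumes "continuous_on {0..2 * pi} (\<lambda>\<theta>. f (a + cis \<theta> *\<^sub>C b))"
  shows "circle_mean (\<lambda>x. ereal (f x)) a b
    = ereal (1 / (2 * pi) * integral {0..2 * pi} (\<lambda>\<theta>. f (a + cis \<theta> *\<^sub>C b)))"
proof -
  define h where "h = (\<lambda>\<theta>. f (a + cis \<theta> *\<^sub>C b))"
  define k where "k = (\<lambda>\<theta>. indicator {0..2*pi} \<theta> *\<^sub>R h \<theta>)"
  have si: "set_integrable lborel {0..2*pi} h"
    using assms unfolding h_def by (rule borel_integrable_atLeastAtMost')
  then have ki: "integrable lborel k"
    by (simp add: set_integrable_def k_def)
  have "integral {0..2*pi} h = integral\<^sup>L lborel k"
    using set_borel_integral_eq_integral(2)[OF si]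
    by (simp add: set_lebesgue_integral_def k_def)
  also have "\<dots> = enn2real (\<integral>\<^sup>+x. ennreal (k x) \<partial>lborel) - enn2real (\<integral>\<^sup>+x. ennreal (- k x) \<partial>lborel)"
    by (rule real_lebesgue_integral_def[OF ki])
  finally have eq: "integral {0..2*pi} h = \<dots>" .
  have fin: "(\<integral>\<^sup>+x. ennreal (k x) \<partial>lborel) \<noteq> \<infinity>" "(\<integral>\<^sup>+x. ennreal (- k x) \<partial>lborel) \<noteq> \<infinity>"
    using ki by (simp_all add: real_integrable_def)
  have "(\<integral>\<^sup>+\<theta>\<in>{0..2 * pi}. e2ennreal (ereal (h \<theta>)) \<partial>lborel) = (\<integral>\<^sup>+x. ennreal (k x) \<partial>lborel)"
       "(\<integral>\<^sup>+\<theta>\<in>{0..2 * pi}. e2ennreal (- ereal (h \<theta>)) \<partial>lborel) = (\<integral>\<^sup>+x. ennreal (- k x) \<partial>lborel)"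
    by (auto intro!: nn_integral_cong simp: k_def split: split_indicator)
  moreover have "enn2ereal X = ereal (enn2real X)" if "X \<noteq> \<infinity>" for X
    using that by (cases X) auto
  ultimately show ?thesis
    unfolding circle_mean_def cis_conv_exp[symmetric] h_def[symmetric]
    using fin eq by (simp add: h_def)
qed

text \<open>Comparing increments by integration of the derivatives allows one-sided derivatives at
  the end points, which is what differentiation under the integral on $[0, 1]$ provides.\<close>

lemma increment_le_increment:
  fixes F G :: "real \<Rightarrow> real"
  assumes "x \<le> y"
    and "\<And>s. s \<in> {x..y} \<Longrightarrow> (F has_vector_derivative F' s) (at s within {x..y})"
    and "\<And>s. s \<in> {x..y} \<Longrightarrow> (G has_vector_derivative G' s) (at s within {x..y})"
    and "\<And>s. s \<in> {x..y} \<Longrightarrow> F' s \<le> G' s"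
  shows "F y - F x \<le> G y - G x"
  using fundamental_theorem_of_calculus[of x y F F'] fundamental_theorem_of_calculus[of x y G G'] assms
  by (meson has_integral_le)

text \<open>The proof is the classical one for subharmonic functions in polar coordinates. With
  $e = e^{i\theta} b$ and $p = a + re$, let $G(r) = \int f(p)\,d\theta$ and
  $K(r) = r G'(r) = \int f'(p)(re)\,d\theta$. Then
  $K'(r) = \int f'(p)(e) + r f''(p)(e, e)\,d\theta$, while
  $\frac{\partial}{\partial\theta} f'(p)(ie) = r f''(p)(ie, ie) - f'(p)(e)$ integrates to $0$ over the
  period. Adding the two cancels the first-order terms and leaves
  $K'(r) = 4r \int L_p(e)\,d\theta \ge 8\pi c r$; two integrations give
  $G(1) - G(0) \ge 2\pi c$. Working with $K$ instead of $G''$ avoids any division by $r$ in the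
  differential inequality.\<close>

lemma circle_mean_ge_of_levi_form_ge:
  fixes f :: "'a::complex_normed_vector \<Rightarrow> real"
    and f' :: "'a \<Rightarrow> 'a \<Rightarrow>\<^sub>L real" and f'' :: "'a \<Rightarrow> 'a \<Rightarrow>\<^sub>L 'a \<Rightarrow>\<^sub>L real"
  assumes f: "\<And>x. x \<in> S \<Longrightarrow> (f has_derivative blinfun_apply (f' x)) (at x)"
    and f': "\<And>x. x \<in> S \<Longrightarrow> (f' has_derivative blinfun_apply (f'' x)) (at x)"
    and f'': "continuous_on S f''"
    and disc: "\<And>z. cmod z \<le> 1 \<Longrightarrow> a + z *\<^sub>C b \<in> S"
    and levi: "\<And>z. cmod z \<le> 1 \<Longrightarrow> c \<le> levi_form (f'' (a + z *\<^sub>C b)) b"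
  shows "f a + c \<le> 1 / (2 * pi) * integral {0..2 * pi} (\<lambda>\<theta>. f (a + cis \<theta> *\<^sub>C b))"
proof -
  define e where "e = (\<lambda>\<theta>. cis \<theta> *\<^sub>C b)"
  define p where "p = (\<lambda>r \<theta>. a + r *\<^sub>R e \<theta>)"
  have p_in: "p r \<theta> \<in> S" if "r \<in> {0..1}" for r \<theta>
    using disc[of "of_real r * cis \<theta>"] that by (simp add: p_def e_def scaleR_scaleC norm_mult)
  have levi_e: "4 * c \<le> f'' (p r \<theta>) (e \<theta>) (e \<theta>) + f'' (p r \<theta>) (\<i> *\<^sub>C e \<theta>) (\<i> *\<^sub>C e \<theta>)"
    if "r \<in> {0..1}" for r \<theta>
  proof -
    have "c \<le> levi_form (f'' (p r \<theta>)) (e \<theta>)"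
      using levi[of "of_real r * cis \<theta>"] that
      by (simp add: p_def e_def scaleR_scaleC norm_mult levi_form_scaleC)
    then show ?thesis
      by (simp add: levi_form_def)
  qed
  have e_deriv: "(e has_vector_derivative \<i> *\<^sub>C e \<theta>) (at \<theta> within T)" for \<theta> T
  proof -
    have "((\<lambda>\<theta>. cis \<theta>) has_vector_derivative \<i> * cis \<theta>) (at \<theta> within T)"
      unfolding has_vector_derivative_def
      by (auto intro!: derivative_eq_intros simp: scaleR_conv_of_real)
    from bounded_linear.has_vector_derivative[OF
        bounded_bilinear.bounded_linear_left[OF bounded_bilinear_scaleC] this]
    show ?thesis
      by (simp add: e_def scaleC_scaleC)
  qed
  have ie_deriv: "((\<lambda>\<theta>. \<i> *\<^sub>C e \<theta>) has_vector_derivative - e \<theta>) (at \<theta> within T)" for \<theta> T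
    using bounded_linear.has_vector_derivative[OF bounded_linear_scaleC_right e_deriv, of \<i>]
    by (simp add: scaleC_i_i)
  have [continuous_intros]: "continuous_on T (\<lambda>x. e (g x))" if "continuous_on T g"
    for T and g :: "'b::topological_space \<Rightarrow> real"
    unfolding e_def using that
    by (intro bounded_bilinear.continuous_on[OF bounded_bilinear_scaleC] continuous_intros)
  have p_r: "((\<lambda>r. p r \<theta>) has_vector_derivative e \<theta>) (at r within T)" for r \<theta> T
    unfolding p_def by (auto intro!: derivative_eq_intros)
  have p_\<theta>: "(p r has_vector_derivative r *\<^sub>R (\<i> *\<^sub>C e \<theta>)) (at \<theta> within T)" for r \<theta> T
    unfolding p_def by (auto intro!: derivative_eq_intros e_deriv)
  have chain: "((\<lambda>s. g (q s)) has_vector_derivative (D v)) (at s within T)"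
    if "(q has_vector_derivative v) (at s within T)" "(g has_derivative D) (at (q s))"
    for g :: "'a \<Rightarrow> 'c::real_normed_vector" and q D v s T
    using vector_derivative_diff_chain_within[OF that(1) has_derivative_at_withinI[OF that(2)]]
    by (simp add: o_def)
  \<comment> \<open>The product rule for the evaluation of an operator-valued curve along a vector-valued one.\<close>
  note prod = bounded_bilinear.has_vector_derivative[OF bounded_bilinear_blinfun_apply]
  have cont_f: "continuous_on S f" and cont_f': "continuous_on S f'"
    using f f' by (auto intro!: continuous_at_imp_continuous_on dest: has_derivative_continuous)
  have cont_p: "continuous_on T (\<lambda>x. h (p (r x) (\<theta> x)))"
    if "continuous_on S h" "continuous_on T r" "continuous_on T \<theta>" "\<And>x. x \<in> T \<Longrightarrow> r x \<in> {0..1}"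
    for T and h :: "'a \<Rightarrow> 'c::real_normed_vector" and r \<theta> :: "'b::topological_space \<Rightarrow> real"
  proof (rule continuous_on_compose2[OF that(1)])
    show "continuous_on T (\<lambda>x. p (r x) (\<theta> x))"
      unfolding p_def by (intro continuous_intros that)
    show "(\<lambda>x. p (r x) (\<theta> x)) ` T \<subseteq> S"
      using that(4) p_in by auto
  qed
  note [continuous_intros] = cont_p[OF cont_f] cont_p[OF cont_f'] cont_p[OF f'']
  define G where "G = (\<lambda>r. integral {0..2*pi} (\<lambda>\<theta>. f (p r \<theta>)))"
  define K where "K = (\<lambda>r. integral {0..2*pi} (\<lambda>\<theta>. f' (p r \<theta>) (r *\<^sub>R e \<theta>)))"
  define G' where "G' = (\<lambda>r. integral {0..2*pi} (\<lambda>\<theta>. f' (p r \<theta>) (e \<theta>)))"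
  \<comment> \<open>\<open>k r\<close> is the \<open>r\<close>-derivative of the integrand of \<open>K\<close>.\<close>
  define k where "k = (\<lambda>r \<theta>. f' (p r \<theta>) (e \<theta>) + f'' (p r \<theta>) (e \<theta>) (r *\<^sub>R e \<theta>))"
  have G_deriv: "(G has_vector_derivative G' r) (at r within {0..1})" if "r \<in> {0..1}" for r
    unfolding G_def G'_def
  proof (rule leibniz_rule_vector_derivative[where a = 0 and b = "2 * pi", unfolded cbox_interval])
    fix x t :: real assume "x \<in> {0..1}"
    then show "((\<lambda>x. f (p x t)) has_vector_derivative f' (p x t) (e t)) (at x within {0..1})"
      by (intro chain[OF p_r f] p_in)
    show "(\<lambda>\<theta>. f (p x \<theta>)) integrable_on {0..2 * pi}"
      using \<open>x \<in> {0..1}\<close> by (intro integrable_continuous_real continuous_intros) auto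
  next
    show "continuous_on ({0..1} \<times> {0..2 * pi}) (\<lambda>(x, t). f' (p x t) (e t))"
      unfolding split_beta by (intro continuous_intros) auto
  qed (use that in auto)
  have K_deriv: "(K has_vector_derivative integral {0..2*pi} (k r)) (at r within {0..1})"
    if "r \<in> {0..1}" for r
    unfolding K_def k_def
  proof (rule leibniz_rule_vector_derivative[where a = 0 and b = "2 * pi", unfolded cbox_interval])
    fix x t :: real assume "x \<in> {0..1}"
    then have "((\<lambda>x. f' (p x t)) has_vector_derivative f'' (p x t) (e t)) (at x within {0..1})"
      by (intro chain[OF p_r f'] p_in)
    moreover have "((\<lambda>x. x *\<^sub>R e t) has_vector_derivative e t) (at x within {0..1})"
      by (auto intro!: derivative_eq_intros)
    ultimately show "((\<lambda>x. f' (p x t) (x *\<^sub>R e t)) has_vector_derivative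
        f' (p x t) (e t) + f'' (p x t) (e t) (x *\<^sub>R e t)) (at x within {0..1})"
      by (rule prod)
    show "(\<lambda>\<theta>. f' (p x \<theta>) (x *\<^sub>R e \<theta>)) integrable_on {0..2 * pi}"
      using \<open>x \<in> {0..1}\<close> by (intro integrable_continuous_real continuous_intros) auto
  next
    show "continuous_on ({0..1} \<times> {0..2 * pi})
       (\<lambda>(x, t). f' (p x t) (e t) + f'' (p x t) (e t) (x *\<^sub>R e t))"
      unfolding split_beta by (intro continuous_intros) auto
  qed (use that in auto)
  have K'_ge: "8 * pi * c * r \<le> integral {0..2*pi} (k r)" if r: "r \<in> {0..1}" for r
  proof -
    \<comment> \<open>\<open>w\<close> is the angular derivative of \<open>f' p (i e)\<close>, which is periodic.\<close>
    define w where "w = (\<lambda>\<theta>. f' (p r \<theta>) (- e \<theta>) + f'' (p r \<theta>) (r *\<^sub>R (\<i> *\<^sub>C e \<theta>)) (\<i> *\<^sub>C e \<theta>))"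
    have "((\<lambda>\<theta>. f' (p r \<theta>) (\<i> *\<^sub>C e \<theta>)) has_vector_derivative w \<theta>) (at \<theta> within {0..2*pi})" for \<theta>
      unfolding w_def by (rule prod[OF chain[OF p_\<theta> f'[OF p_in[OF r]]] ie_deriv])
    then have "(w has_integral f' (p r (2*pi)) (\<i> *\<^sub>C e (2*pi)) - f' (p r 0) (\<i> *\<^sub>C e 0)) {0..2*pi}"
      by (intro fundamental_theorem_of_calculus) auto
    then have w0: "(w has_integral 0) {0..2*pi}"
      by (simp add: p_def e_def)
    have "k r integrable_on {0..2*pi}"
      unfolding k_def using r by (intro integrable_continuous_real continuous_intros) auto
    then have "(k r has_integral integral {0..2*pi} (k r)) {0..2*pi}"
      by (simp add: integrable_integral)
    from has_integral_add[OF this w0]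
    have "((\<lambda>\<theta>. k r \<theta> + w \<theta>) has_integral integral {0..2*pi} (k r)) {0..2*pi}"
      by simp
    moreover have "((\<lambda>\<theta>::real. r * (4 * c)) has_integral (2 * pi * (r * (4 * c)))) {0..2*pi}"
      using has_integral_const_real[of "r * (4 * c)" 0 "2*pi"] by simp
    moreover have "r * (4 * c) \<le> k r \<theta> + w \<theta>" for \<theta>
    proof -
      have "k r \<theta> + w \<theta> = r * (f'' (p r \<theta>) (e \<theta>) (e \<theta>) + f'' (p r \<theta>) (\<i> *\<^sub>C e \<theta>) (\<i> *\<^sub>C e \<theta>))"
        by (simp add: k_def w_def blinfun.bilinear_simps algebra_simps)
      then show ?thesis
        using levi_e[OF r, of \<theta>] r by (simp add: mult_left_mono)
    qed
    ultimately have "2 * pi * (r * (4 * c)) \<le> integral {0..2*pi} (k r)"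
      by (meson has_integral_le)
    then show ?thesis
      by (simp add: algebra_simps)
  qed
  have K_ge: "4 * pi * c * r\<^sup>2 \<le> K r" if r: "r \<in> {0..1}" for r
  proof -
    have "4 * pi * c * r\<^sup>2 - 4 * pi * c * 0\<^sup>2 \<le> K r - K 0"
    proof (rule increment_le_increment)
      fix s assume s: "s \<in> {0..r}"
      show "((\<lambda>r. 4 * pi * c * r\<^sup>2) has_vector_derivative 8 * pi * c * s) (at s within {0..r})"
        by (auto intro!: derivative_eq_intros simp flip: has_real_derivative_iff_has_vector_derivative)
      show "(K has_vector_derivative integral {0..2*pi} (k s)) (at s within {0..r})"
        using s r by (intro has_vector_derivative_within_subset[OF K_deriv]) auto
      show "8 * pi * c * s \<le> integral {0..2*pi} (k s)"
        using s r by (intro K'_ge) auto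
    qed (use r in auto)
    then show ?thesis
      by (simp add: K_def)
  qed
  have G'_ge: "4 * pi * c * r \<le> G' r" if r: "r \<in> {0..1}" for r
  proof (cases "r = 0")
    case True
    \<comment> \<open>At the centre, \<open>f' a\<close> is a fixed linear map and \<open>e\<close> is the derivative of the periodic \<open>- i e\<close>.\<close>
    have "((\<lambda>\<theta>. f' a (e \<theta>)) has_integral f' a (- \<i> *\<^sub>C e (2*pi)) - f' a (- \<i> *\<^sub>C e 0)) {0..2*pi}"
    proof (rule fundamental_theorem_of_calculus)
      fix \<theta> :: real
      have "((\<lambda>\<theta>. - (\<i> *\<^sub>C e \<theta>)) has_vector_derivative e \<theta>) (at \<theta> within {0..2*pi})"
        using has_vector_derivative_minus[OF ie_deriv] by simp
      then have "((\<lambda>\<theta>. (- \<i>) *\<^sub>C e \<theta>) has_vector_derivative e \<theta>) (at \<theta> within {0..2*pi})"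
        by (simp add: bounded_bilinear.minus_left[OF bounded_bilinear_scaleC])
      then show "((\<lambda>\<theta>. f' a (- \<i> *\<^sub>C e \<theta>)) has_vector_derivative f' a (e \<theta>)) (at \<theta> within {0..2*pi})"
        by (rule bounded_linear.has_vector_derivative[OF blinfun.bounded_linear_right])
    qed simp
    then have "((\<lambda>\<theta>. f' a (e \<theta>)) has_integral 0) {0..2*pi}"
      by (simp add: e_def)
    then show ?thesis
      using True by (simp add: G'_def p_def integral_unique)
  next
    case False
    have "K r = r * G' r"
      by (simp add: K_def G'_def blinfun.bilinear_simps)
    with K_ge[OF r] have "r * (4 * pi * c * r) \<le> r * G' r"
      by (simp add: power2_eq_square algebra_simps)
    with False r show ?thesis
      by simp
  qed
  have "2 * pi * c * 1\<^sup>2 - 2 * pi * c * 0\<^sup>2 \<le> G 1 - G 0"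
  proof (rule increment_le_increment)
    fix s :: real assume s: "s \<in> {0..1}"
    show "((\<lambda>r. 2 * pi * c * r\<^sup>2) has_vector_derivative 4 * pi * c * s) (at s within {0..1})"
      by (auto intro!: derivative_eq_intros simp flip: has_real_derivative_iff_has_vector_derivative)
  qed (use G_deriv G'_ge in auto)
  moreover have "G 0 = 2 * pi * f a"
    by (simp add: G_def p_def)
  moreover have "G 1 = integral {0..2 * pi} (\<lambda>\<theta>. f (a + cis \<theta> *\<^sub>C b))"
    by (simp add: G_def p_def e_def)
  ultimately show ?thesis
    by (simp add: field_simps)
qed

section \<open>The two implications\<close>

text \<open>Extend $\psi$ by $0$ to $\psi_0$ and take $\mu(x) = \inf_y (\psi_0(y) + d(x, y))$, the largest
  1-Lipschitz function below $\psi_0$. It is positive at $x \in U$, because near $x$ the function $\psi_0$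
  exceeds $\psi(x)/2$ and elsewhere the distance term is bounded below. The extension by $0$
  makes $\mu$ a lower bound also for the distance to the complement of $U$.\<close>

lemma ex_positive_Lipschitz_minorant:
  fixes \<psi> :: "'a::metric_space \<Rightarrow> real"
  assumes "open U" and "continuous_on U \<psi>" and pos: "\<And>x. x \<in> U \<Longrightarrow> 0 < \<psi> x"
  obtains \<mu> :: "'a \<Rightarrow> real"
  where "\<And>x. x \<in> U \<Longrightarrow> 0 < \<mu> x" and "\<And>x. x \<in> U \<Longrightarrow> \<mu> x \<le> \<psi> x"
    and "\<And>x. x \<notin> U \<Longrightarrow> \<mu> x \<le> 0" and "\<And>x y. \<mu> x \<le> \<mu> y + dist x y"
proof -
  define \<psi>\<^sub>0 where "\<psi>\<^sub>0 = (\<lambda>x. if x \<in> U then \<psi> x else 0)"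
  define \<mu> where "\<mu> = (\<lambda>x. INF y. \<psi>\<^sub>0 y + dist x y)"
  have nonneg: "0 \<le> \<psi>\<^sub>0 x" for x
    using pos[of x] by (auto simp: \<psi>\<^sub>0_def)
  then have bdd: "bdd_below (range (\<lambda>y. \<psi>\<^sub>0 y + dist x y))" for x
    by (intro bdd_belowI[of _ 0]) (auto simp: add_nonneg_nonneg)
  have le: "\<mu> x \<le> \<psi>\<^sub>0 y + dist x y" for x y
    unfolding \<mu>_def by (rule cINF_lower[OF bdd]) simp
  have "0 < \<mu> x" if x: "x \<in> U" for x
  proof -
    have "isCont \<psi> x"
      using assms x by (simp add: continuous_on_eq_continuous_at)
    then have "\<forall>\<^sub>F y in nhds x. \<psi> x / 2 < \<psi> y"
      using pos[OF x] by (intro order_tendstoD(1)[OF tendsto_at_iff_tendsto_nhds[THEN iffD1]]) (auto simp: isCont_def)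
    moreover have "\<forall>\<^sub>F y in nhds x. y \<in> U"
      using assms x by (simp add: eventually_nhds_in_open)
    ultimately have "\<forall>\<^sub>F y in nhds x. y \<in> U \<and> \<psi> x / 2 < \<psi> y"
      by eventually_elim simp
    then obtain d where d: "d > 0" "\<And>y. dist y x < d \<Longrightarrow> y \<in> U \<and> \<psi> x / 2 < \<psi> y"
      by (auto simp: eventually_nhds_metric)
    have "min d (\<psi> x / 2) \<le> \<mu> x"
      unfolding \<mu>_def
    proof (rule cINF_greatest)
      fix y
      show "min d (\<psi> x / 2) \<le> \<psi>\<^sub>0 y + dist x y"
      proof (cases "dist y x < d")
        case True
        then show ?thesis
          using d(2)[OF True] by (simp add: \<psi>\<^sub>0_def min_def add_nonneg_nonneg)
             (smt (verit) zero_le_dist)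
      next
        case False
        then show ?thesis
          using nonneg[of y] by (simp add: dist_commute min_def)
      qed
    qed simp
    then show ?thesis
      using d(1) pos[OF x] by (simp add: min_def split: if_splits)
  qed
  moreover have "\<mu> x \<le> \<psi> x" if "x \<in> U" for x
    using le[of x x] that by (simp add: \<psi>\<^sub>0_def)
  moreover have "\<mu> x \<le> 0" if "x \<notin> U" for x
    using le[of x x] that by (simp add: \<psi>\<^sub>0_def)
  moreover have "\<mu> x \<le> \<mu> y + dist x y" for x y
  proof -
    have "\<mu> x - dist x y \<le> \<mu> y"
      unfolding \<mu>_def[THEN fun_cong, of y]
    proof (rule cINF_greatest)
      fix z
      show "\<mu> x - dist x y \<le> \<psi>\<^sub>0 z + dist y z"
        using le[of x z] dist_triangle[of x z y] by simp
    qed simp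
    then show ?thesis by simp
  qed
  ultimately show ?thesis
    by (rule that)
qed

lemma lower_semicontinuous_on_if_continuous_on:
  "continuous_on U g \<Longrightarrow> lower_semicontinuous_on U g"
  unfolding lower_semicontinuous_on_def
  using continuous_openin_preimage[of U g UNIV "{c<..}" for c]
  by (auto simp: vimage_def Int_def)

lemma upper_semicontinuous_on_if_continuous_on:
  "continuous_on U g \<Longrightarrow> upper_semicontinuous_on U g"
  unfolding upper_semicontinuous_on_def
  using continuous_openin_preimage[of U g UNIV "{..<c}" for c]
  by (auto simp: vimage_def Int_def)

context
  fixes U :: "'a::complex_normed_vector set" and f :: "'a \<Rightarrow> real"
  assumes open_U: "open U" and C2: "C2_on U f"
begin

lemma has_derivative_fderiv: "x \<in> U \<Longrightarrow> (f has_derivative blinfun_apply (fderiv f x)) (at x)"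
  and has_derivative_fderiv_fderiv:
    "x \<in> U \<Longrightarrow> (fderiv f has_derivative blinfun_apply (fderiv (fderiv f) x)) (at x)"
  and continuous_on_fderiv_fderiv: "continuous_on U (fderiv (fderiv f))"
  using C2 by (auto simp: C2_on_def intro: fderiv_has_derivative)

lemma continuous_on_C2: "continuous_on U f"
  using has_derivative_fderiv by (auto intro!: continuous_at_imp_continuous_on dest: has_derivative_continuous)

lemma circle_mean_C2:
  assumes "\<And>z. cmod z \<le> 1 \<Longrightarrow> a + z *\<^sub>C b \<in> U"
  shows "circle_mean (\<lambda>x. ereal (f x)) a b
    = ereal (1 / (2 * pi) * integral {0..2 * pi} (\<lambda>\<theta>. f (a + cis \<theta> *\<^sub>C b)))"
proof (rule circle_mean_continuous, rule continuous_on_compose2[OF continuous_on_C2])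
  show "continuous_on {0..2 * pi} (\<lambda>\<theta>. a + cis \<theta> *\<^sub>C b)"
    by (intro continuous_intros bounded_bilinear.continuous_on[OF bounded_bilinear_scaleC])
qed (use assms in auto)

lemma strictly_psh_on_average_if_strictly_psh:
  assumes "strictly_psh_continuously U f"
  shows "strictly_psh_on_average_continuously U (\<lambda>x. ereal (f x))"
proof -
  obtain \<psi> where \<psi>: "continuous_on U \<psi>" "\<And>a. a \<in> U \<Longrightarrow> 0 < \<psi> a"
    and levi: "\<And>a b. a \<in> U \<Longrightarrow> \<psi> a * (norm b)\<^sup>2 \<le> levi_form (fderiv (fderiv f) a) b"
    using assms Re_complex_hessian[OF open_U C2] unfolding strictly_psh_continuously_def by metis
  obtain \<mu> where pos: "\<And>x. x \<in> U \<Longrightarrow> 0 < \<mu> x" and le: "\<And>x. x \<in> U \<Longrightarrow> \<mu> x \<le> \<psi> x"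
    and off: "\<And>x. x \<notin> U \<Longrightarrow> \<mu> x \<le> 0" and lip: "\<And>x y. \<mu> x \<le> \<mu> y + dist x y"
    using ex_positive_Lipschitz_minorant[OF open_U \<psi>] by blast
  have "1-lipschitz_on U \<mu>"
    using lip by (intro lipschitz_onI) (auto simp: dist_real_def abs_le_iff algebra_simps, metis dist_commute)
  then have cont: "continuous_on U (\<lambda>a. \<mu> a / 2)"
    by (intro continuous_intros lipschitz_on_continuous_on) auto
  have "(\<forall>z. cmod z \<le> 1 \<longrightarrow> a + z *\<^sub>C b \<in> U) \<and>
      ereal (\<mu> a / 2 * (norm b)\<^sup>2) + ereal (f a) \<le> circle_mean (\<lambda>x. ereal (f x)) a b"
    if a: "a \<in> U" and b: "norm b < \<mu> a / 2" for a b
  proof -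
    have half: "\<mu> a / 2 < \<mu> (a + z *\<^sub>C b)" if "cmod z \<le> 1" for z
    proof -
      have "norm (z *\<^sub>C b) \<le> norm b"
        using that by (simp add: norm_scaleC mult_left_le_one_le)
      then show ?thesis
        using lip[of a "a + z *\<^sub>C b"] b by (simp add: dist_norm)
    qed
    have disc: "a + z *\<^sub>C b \<in> U" if "cmod z \<le> 1" for z
      using half[OF that] off pos[OF a] by force
    have "f a + \<mu> a / 2 * (norm b)\<^sup>2
        \<le> 1 / (2 * pi) * integral {0..2 * pi} (\<lambda>\<theta>. f (a + cis \<theta> *\<^sub>C b))"
    proof (rule circle_mean_ge_of_levi_form_ge[OF has_derivative_fderiv
          has_derivative_fderiv_fderiv continuous_on_fderiv_fderiv disc])
      fix z assume z: "cmod z \<le> 1"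
      have "\<mu> a / 2 * (norm b)\<^sup>2 \<le> \<psi> (a + z *\<^sub>C b) * (norm b)\<^sup>2"
        using half[OF z] le[OF disc[OF z]] by (intro mult_right_mono) auto
      also have "\<dots> \<le> levi_form (fderiv (fderiv f) (a + z *\<^sub>C b)) b"
        by (rule levi[OF disc[OF z]])
      finally show "\<mu> a / 2 * (norm b)\<^sup>2 \<le> levi_form (fderiv (fderiv f) (a + z *\<^sub>C b)) b" .
    qed
    then show ?thesis
      using disc circle_mean_C2[of a b] by (simp add: add.commute)
  qed
  moreover have "upper_semicontinuous_on U (\<lambda>x. ereal (f x))"
    by (intro upper_semicontinuous_on_if_continuous_on continuous_intros continuous_on_C2)
  ultimately show ?thesis
    unfolding strictly_psh_on_average_continuously_def
    using cont lower_semicontinuous_on_if_continuous_on[OF cont] pos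
    by (intro conjI exI[of _ "\<lambda>a. \<mu> a / 2"]) auto
qed

text \<open>The comparison lemma is applied to $-f$ on a disc so small that the Levi form has not yet
  reached the number $c$ chosen strictly between the two sides.\<close>

lemma strictly_psh_if_strictly_psh_on_average:
  assumes "strictly_psh_on_average_continuously U (\<lambda>x. ereal (f x))"
  shows "strictly_psh_continuously U f"
proof -
  obtain \<phi> \<delta> :: "'a \<Rightarrow> real" where \<phi>: "continuous_on U \<phi>" "\<And>a. a \<in> U \<Longrightarrow> 0 < \<phi> a"
    and \<delta>: "\<And>a. a \<in> U \<Longrightarrow> 0 < \<delta> a"
    and disc: "\<And>a b z. a \<in> U \<Longrightarrow> norm b < \<delta> a \<Longrightarrow> cmod z \<le> 1 \<Longrightarrow> a + z *\<^sub>C b \<in> U"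
    and mean: "\<And>a b. a \<in> U \<Longrightarrow> norm b < \<delta> a \<Longrightarrow>
        ereal (\<phi> a * (norm b)\<^sup>2) + ereal (f a) \<le> circle_mean (\<lambda>x. ereal (f x)) a b"
    using assms unfolding strictly_psh_on_average_continuously_def by metis
  have "\<phi> a * (norm b)\<^sup>2 \<le> levi_form (fderiv (fderiv f) a) b" if a: "a \<in> U" for a b
  proof (rule ccontr)
    assume "\<not> ?thesis"
    then obtain c where c: "levi_form (fderiv (fderiv f) a) b < c" "c < \<phi> a * (norm b)\<^sup>2"
      using dense not_le by blast
    have "continuous_on U (\<lambda>x. levi_form (fderiv (fderiv f) x) b)"
      unfolding levi_form_def by (intro continuous_intros continuous_on_fderiv_fderiv) auto
    then have "isCont (\<lambda>x. levi_form (fderiv (fderiv f) x) b) a"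
      using open_U a by (simp add: continuous_on_eq_continuous_at)
    then have "\<forall>\<^sub>F x in nhds a. levi_form (fderiv (fderiv f) x) b < c"
      using c(1) by (intro order_tendstoD(2)[OF tendsto_at_iff_tendsto_nhds[THEN iffD1]]) (auto simp: isCont_def)
    then obtain d where d: "d > 0"
      "\<And>x. dist x a < d \<Longrightarrow> levi_form (fderiv (fderiv f) x) b < c"
      by (auto simp: eventually_nhds_metric)
    \<comment> \<open>The summand 1 covers \<open>b = 0\<close> and makes the bound on \<open>norm (t b)\<close> strict.\<close>
    define t where "t = min d (\<delta> a) / (norm b + 1)"
    have t: "t > 0"
      using d(1) \<delta>[OF a] by (simp add: t_def add_nonneg_pos)
    define v where "v = complex_of_real t *\<^sub>C b"
    have norm_v: "norm v = t * norm b"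
      using t by (simp add: v_def norm_scaleC)
    also have "\<dots> < t * (norm b + 1)"
      using t by simp
    also have "\<dots> = min d (\<delta> a)"
      using norm_ge_zero[of b] by (simp add: t_def add_nonneg_eq_0_iff)
    finally have v: "norm v < d" "norm v < \<delta> a"
      by simp_all
    have "- f a + - (t\<^sup>2 * c)
        \<le> 1 / (2 * pi) * integral {0..2 * pi} (\<lambda>\<theta>. - f (a + cis \<theta> *\<^sub>C v))"
    proof (rule circle_mean_ge_of_levi_form_ge)
      show "((\<lambda>x. - f x) has_derivative blinfun_apply (- fderiv f x)) (at x)" if "x \<in> U" for x
        using has_derivative_minus[OF has_derivative_fderiv[OF that]]
        by (rule has_derivative_eq_rhs) (simp add: fun_eq_iff blinfun.minus_left)
      show "((\<lambda>x. - fderiv f x) has_derivative blinfun_apply (- fderiv (fderiv f) x)) (at x)"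
        if "x \<in> U" for x
        using has_derivative_minus[OF has_derivative_fderiv_fderiv[OF that]]
        by (rule has_derivative_eq_rhs) (simp add: fun_eq_iff blinfun.minus_left)
      show "continuous_on U (\<lambda>x. - fderiv (fderiv f) x)"
        by (intro continuous_intros continuous_on_fderiv_fderiv)
      fix z assume z: "cmod z \<le> 1"
      show "a + z *\<^sub>C v \<in> U"
        by (rule disc[OF a v(2) z])
      have "norm (z *\<^sub>C v) \<le> norm v"
        using z by (simp add: norm_scaleC mult_left_le_one_le)
      then have "levi_form (fderiv (fderiv f) (a + z *\<^sub>C v)) b < c"
        using v(1) by (intro d(2)) (simp add: dist_norm)
      then show "- (t\<^sup>2 * c) \<le> levi_form (- fderiv (fderiv f) (a + z *\<^sub>C v)) v"
        using t by (simp add: levi_form_uminus v_def levi_form_scaleC mult_left_mono)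
    qed
    moreover have "\<phi> a * (norm v)\<^sup>2 + f a
        \<le> 1 / (2 * pi) * integral {0..2 * pi} (\<lambda>\<theta>. f (a + cis \<theta> *\<^sub>C v))"
      using mean[OF a v(2)] circle_mean_C2[of a v] disc[OF a v(2)] by simp
    ultimately have "t\<^sup>2 * (\<phi> a * (norm b)\<^sup>2) \<le> t\<^sup>2 * c"
      by (simp add: norm_v power_mult_distrib algebra_simps)
    then show False
      using t c(2) by simp
  qed
  then show ?thesis
    unfolding strictly_psh_continuously_def
    using C2 \<phi> Re_complex_hessian[OF open_U C2] by (intro conjI exI[of _ \<phi>]) auto
qed

end

theorem proposition2p9:
  fixes U :: "'a::complex_banach set" and f :: "'a \<Rightarrow> real"
  assumes "open U" and "connected U" and "U \<noteq> {}"
    and "C2_on U f"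
  shows "strictly_psh_continuously U f \<longleftrightarrow>
    strictly_psh_on_average_continuously U (\<lambda>x. ereal (f x))"
  using strictly_psh_on_average_if_strictly_psh[OF assms(1,4)]
    strictly_psh_if_strictly_psh_on_average[OF assms(1,4)] by blast

end
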